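(* Let $\mathcal{A},\mathcal{B}\in\mathrm{T}^m(\mathbb{R}^n)$ and let $$p(x)=\Big(\mathcal{B}x^m-1,\ (\mathcal{A}x^m)\,(x\circ\mathcal{B}x^{m-1})-x\circ\mathcal{A}x^{m-1}\Big).$$ If $\mathcal{A},\mathcal{B}$ are generic tensors, then $V_{\mathbb{C}}(p)=\{u\in\mathbb{C}^n: p(u)=0\}$ and $V_{\mathbb{R}}(p)=V_{\mathbb{C}}(p)\cap\mathbb{R}^n$ are finite sets.
   Context: $\mathrm{T}^m(\mathbb{R}^n)$ is the space of real $m$-th order $n$-dimensional tensors (not necessarily symmetric). For a vector $x$ of dimension $n$, $(\mathcal{A}x^{m-1})_i=\sum_{i_2,\ldots,i_m=1}^n\mathcal{A}_{i,i_2,\ldots,i_m}x_{i_2}\cdots x_{i_m}$ and $\mathcal{A}x^m=\sum_i x_i(\mathcal{A}x^{m-1})_i$; $\circ$ is the entrywise product of vectors. A property holds for generic $\mathcal{A},\mathcal{B}$ if it holds for all pairs $(\mathcal{A},\mathcal{B})$ in an open dense subset, in the Zariski topology, of the space of pairs $\mathrm{T}^m(\mathbb{R}^n)\times\mathrm{T}^m(\mathbb{R}^n)$. *)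

theory Defs
  imports "HOL-Analysis.Analysis"
begin

text \<open>
  A tensor of order \<open>m = CARD('m)\<close> and dimension \<open>n = CARD('n)\<close> is a family of reals indexed by
  the multi-indices \<open>'m \<Rightarrow> 'n\<close>. The linear order on \<open>'m\<close> only serves to single out the first index
  \<open>i\<^sub>1\<close>. As types are non-empty, \<open>m \<ge> 1\<close> and \<open>n \<ge> 1\<close>; every such pair arises, e.g. from numeral types.
\<close>

type_synonym ('m, 'n) tensor = "real ^ ('m \<Rightarrow> 'n)"

definition first_index :: "'m::{finite,linorder}" where
  "first_index = Min UNIV"

text \<open>The vector \<open>A x\<^sup>m\<^sup>-\<^sup>1\<close> and the scalar \<open>A x\<^sup>m\<close>, for a vector \<open>x\<close> over a real algebra
  (\<open>\<real>\<close> or \<open>\<complex>\<close>); the sum runs over the multi-indices whose first index is \<open>i\<close>.\<close>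

definition tensor_vec ::
    "('m::{finite,linorder}, 'n::finite) tensor \<Rightarrow> 'a::{real_algebra_1,comm_ring_1} ^ 'n \<Rightarrow> 'a ^ 'n" where
  "tensor_vec A x =
     (\<chi> i. \<Sum>f | f first_index = i. of_real (A $ f) * (\<Prod>k\<in>UNIV - {first_index}. x $ f k))"

definition tensor_form ::
    "('m::{finite,linorder}, 'n::finite) tensor \<Rightarrow> 'a::{real_algebra_1,comm_ring_1} ^ 'n \<Rightarrow> 'a" where
  "tensor_form A x = (\<Sum>i\<in>UNIV. x $ i * tensor_vec A x $ i)"

text \<open>On type \<open>vec\<close>, multiplication \<open>*\<close> is the entrywise product.\<close>

definition eig_system ::
    "('m::{finite,linorder}, 'n::finite) tensor \<Rightarrow> ('m, 'n) tensor \<Rightarrow>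
       'a::{real_algebra_1,comm_ring_1} ^ 'n \<Rightarrow> 'a \<times> ('a ^ 'n)" where
  "eig_system A B x =
     (tensor_form B x - 1, tensor_form A x *s (x * tensor_vec B x) - x * tensor_vec A x)"

definition complex_variety ::
    "('m::{finite,linorder}, 'n::finite) tensor \<Rightarrow> ('m, 'n) tensor \<Rightarrow> (complex ^ 'n) set" where
  "complex_variety A B = {u. eig_system A B u = 0}"

definition real_variety ::
    "('m::{finite,linorder}, 'n::finite) tensor \<Rightarrow> ('m, 'n) tensor \<Rightarrow> (complex ^ 'n) set" where
  "real_variety A B = complex_variety A B \<inter> {u. \<forall>i. u $ i \<in> \<real>}"

text \<open>The Zariski topology on a real affine space: the closed sets are the common zero sets of
  (arbitrary) families of real polynomial functions.\<close>

definition zariski_open :: "'a::euclidean_space set \<Rightarrow> bool" where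
  "zariski_open U \<longleftrightarrow>
     (\<exists>F. (\<forall>f\<in>F. real_polynomial_function f) \<and> U = - {x. \<forall>f\<in>F. f x = 0})"

definition zariski :: "'a::euclidean_space topology" where
  "zariski = topology zariski_open"

lemma istopology_zariski_open: "istopology (zariski_open :: 'a::euclidean_space set \<Rightarrow> bool)"
  unfolding istopology_def
proof (intro conjI allI impI)
  fix S T :: "'a set"
  assume "zariski_open S" and "zariski_open T"
  then obtain F G where F: "\<forall>f\<in>F. real_polynomial_function f" "S = - {x. \<forall>f\<in>F. f x = 0}"
    and G: "\<forall>g\<in>G. real_polynomial_function g" "T = - {x. \<forall>g\<in>G. g x = 0}"
    unfolding zariski_open_def by blast
  define H where "H = (\<lambda>(f, g) x. f x * g x) ` (F \<times> G)"
  have "\<forall>h\<in>H. real_polynomial_function h"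
    using F(1) G(1) by (simp add: H_def real_polynomial_function.intros(4))
  moreover have "(\<forall>h\<in>H. h x = 0) \<longleftrightarrow> (\<forall>f\<in>F. f x = 0) \<or> (\<forall>g\<in>G. g x = 0)" for x
    by (simp add: H_def)
  then have "S \<inter> T = - {x. \<forall>h\<in>H. h x = 0}"
    unfolding F(2) G(2) by blast
  ultimately show "zariski_open (S \<inter> T)"
    unfolding zariski_open_def by blast
next
  fix K :: "'a set set"
  assume "\<forall>S\<in>K. zariski_open S"
  then have "\<forall>S\<in>K. \<exists>F. (\<forall>f\<in>F. real_polynomial_function f) \<and> S = - {x. \<forall>f\<in>F. f x = 0}"
    unfolding zariski_open_def .
  then obtain F where F: "\<forall>S\<in>K. (\<forall>f\<in>F S. real_polynomial_function f) \<and> S = - {x. \<forall>f\<in>F S. f x = 0}"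
    by (rule bchoice[THEN exE])
  have "\<Union>K = (\<Union>S\<in>K. - {x. \<forall>f\<in>F S. f x = 0})"
  proof -
    have "\<Union>K = (\<Union>S\<in>K. S)" by simp
    also have "\<dots> = (\<Union>S\<in>K. - {x. \<forall>f\<in>F S. f x = 0})"
      by (rule SUP_cong[OF refl]) (rule conjunct2[OF bspec[OF F]])
    finally show ?thesis .
  qed
  also have "\<dots> = - {x. \<forall>f\<in>\<Union>(F ` K). f x = 0}"
    by (simp add: set_eq_iff)
  finally have "\<Union>K = - {x. \<forall>f\<in>\<Union>(F ` K). f x = 0}" .
  moreover have "\<forall>f\<in>\<Union>(F ` K). real_polynomial_function f"
    using F by blast
  ultimately show "zariski_open (\<Union>K)"
    unfolding zariski_open_def by (intro exI conjI)
qed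

lemma openin_zariski [simp]: "openin zariski U \<longleftrightarrow> zariski_open U"
  by (simp add: zariski_def topology_inverse'[OF istopology_zariski_open])

lemma topspace_zariski [simp]: "topspace zariski = (UNIV :: 'a::euclidean_space set)"
proof -
  have "zariski_open (UNIV :: 'a set)"
    unfolding zariski_open_def
    by (rule exI[of _ "{\<lambda>x. 1}"]) (simp add: real_polynomial_function.intros(2))
  then show ?thesis
    by (metis openin_zariski openin_subset top.extremum_unique)
qed

definition generic :: "('a::euclidean_space \<Rightarrow> bool) \<Rightarrow> bool" where
  "generic P \<longleftrightarrow>
     (\<exists>U. openin zariski U \<and> zariski closure_of U = topspace zariski \<and> (\<forall>x\<in>U. P x))"

end

theory Submission
  imports Defs
begin

text \<open>
  Put \<open>h = x \<circ> A x\<^sup>m\<^sup>-\<^sup>1\<close> and \<open>k = x \<circ> B x\<^sup>m\<^sup>-\<^sup>1\<close>. On the variety \<open>h = (A x\<^sup>m) k\<close> and \<open>B x\<^sup>m = 1\<close>, so the forms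
  \<open>h\<^sub>i k\<^sub>j - h\<^sub>j k\<^sub>i\<close> vanish. For diagonal \<open>A = diag a\<close> with distinct \<open>a\<^sub>i\<close> and \<open>B = diag 1\<close>, the form
  \<open>E\<^sub>i = x\<^sub>i\<^sup>m (B x\<^sup>m) - (\<Sum>j\<noteq>i. (h\<^sub>i k\<^sub>j - h\<^sub>j k\<^sub>i) / (a\<^sub>i - a\<^sub>j))\<close> equals \<open>x\<^sub>i\<close> to the power \<open>2m\<close>. Every monomial
  \<open>w\<close> of degree \<open>2mn\<close> is divisible by such a power; replacing the power by \<open>E\<^sub>i\<close> in each \<open>w\<close> gives a square
  matrix \<open>M(A, B)\<close>, polynomial in \<open>(A, B)\<close> and equal to the identity at the diagonal pair. The generic
  set is \<open>det M \<noteq> 0\<close>.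

  On the variety, \<open>E\<^sub>i = x\<^sub>i\<^sup>m\<close>. Hence the nonzero vector \<open>y\<close> of all monomials of degree \<open>2mn\<close> satisfies
  \<open>x\<^sub>l\<^sup>m M y = N\<^sub>l y\<close> with a constant matrix \<open>N\<^sub>l\<close>, so that \<open>t = 1 / x\<^sub>l\<^sup>m\<close> (if \<open>x\<^sub>l \<noteq> 0\<close>) is a root of the
  polynomial \<open>det (M - t N\<^sub>l)\<close>, which does not vanish at \<open>t = 0\<close>. Each coordinate therefore takes
  finitely many values.
\<close>

section \<open>Density of nonempty Zariski open sets\<close>

lemma finite_zeros_on_line:
  fixes f :: "'a::euclidean_space \<Rightarrow> real"
  assumes "real_polynomial_function f" and "f (x + s *\<^sub>R v) \<noteq> 0"
  shows "finite {t. f (x + t *\<^sub>R v) = 0}"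
proof -
  have "polynomial_function (\<lambda>t::real. x + t *\<^sub>R v)"
    by (intro polynomial_function_add polynomial_function_const polynomial_function_mult
        polynomial_function_id)
  from real_polynomial_function_compose[OF this assms(1)]
  obtain a n where "(\<lambda>t. f (x + t *\<^sub>R v)) = (\<lambda>t. \<Sum>i\<le>n. a i * t ^ i)"
    unfolding real_polynomial_function_iff_sum o_def by blast
  then have eq: "f (x + t *\<^sub>R v) = (\<Sum>i\<le>n. a i * t ^ i)" for t
    by metis
  have "\<not> (\<forall>i\<le>n. a i = 0)"
    using assms(2) unfolding eq by (metis (no_types, lifting) atMost_iff mult_zero_left sum.neutral)
  then show ?thesis
    unfolding eq by (subst polyfun_finite_roots) auto
qed

lemma generic_if_nonzero_polynomial:
  fixes f :: "'a::euclidean_space \<Rightarrow> real"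
  assumes f: "real_polynomial_function f" "f a \<noteq> 0"
    and P: "\<And>x. f x \<noteq> 0 \<Longrightarrow> P x"
  shows "generic P"
  unfolding generic_def
proof (intro exI[of _ "{x. f x \<noteq> 0}"] conjI ballI)
  show "openin zariski {x. f x \<noteq> 0}"
    using f(1) by (auto simp: zariski_open_def intro!: exI[of _ "{f}"])
  have "x \<in> zariski closure_of {x. f x \<noteq> 0}" for x
    unfolding in_closure_of
  proof (intro conjI allI impI)
    fix T assume "x \<in> T \<and> openin zariski T"
    then obtain F where F: "\<forall>g\<in>F. real_polynomial_function g" "T = - {x. \<forall>g\<in>F. g x = 0}"
      and "x \<in> T"
      by (auto simp: zariski_open_def)
    then obtain g where g: "g \<in> F" "g x \<noteq> 0"
      by blast
    \<comment> \<open>The line through \<open>x\<close> and \<open>a\<close> meets the nonvanishing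
      set of \<open>g\<close> at t = 0 and that of \<open>f\<close> at t = 1, so each has only
      finitely many roots on it and some t avoids both root sets.\<close>
    have "finite ({t. f (x + t *\<^sub>R (a - x)) = 0} \<union> {t. g (x + t *\<^sub>R (a - x)) = 0})"
      using finite_zeros_on_line[of f x 1 "a - x"]
        finite_zeros_on_line[of g x 0 "a - x"] f F(1) g by simp
    then obtain t where "t \<notin> {t. f (x + t *\<^sub>R (a - x)) = 0} \<union> {t. g (x + t *\<^sub>R (a - x)) = 0}"
      using ex_new_if_finite[OF infinite_UNIV_char_0] by blast
    then show "\<exists>y. y \<in> {x. f x \<noteq> 0} \<and> y \<in> T"
      using g(1) F(2) by blast
  qed simp
  then show "zariski closure_of {x. f x \<noteq> 0} = topspace zariski"
    by auto
qed (use P in auto)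

section \<open>Determinants with polynomial entries\<close>

lemma real_polynomial_function_det:
  fixes M :: "'a::real_normed_vector \<Rightarrow> real ^ 'k ^ 'k"
  assumes "\<And>i j. real_polynomial_function (\<lambda>p. M p $ i $ j)"
  shows "real_polynomial_function (\<lambda>p. det (M p))"
  unfolding det_def
  by (intro real_polynomial_function_sum real_polynomial_function_prod
      real_polynomial_function.intros assms) auto

lemma det_of_real:
  "det (\<chi> i j. of_real (M $ i $ j) :: complex ^ 'k ^ 'k) = of_real (det (M :: real ^ 'k ^ 'k))"
  by (simp add: det_def)

lemma finite_det_pencil:
  fixes M N :: "'a::field ^ 'k ^ 'k"
  assumes "det M \<noteq> 0"
  shows "finite {t. det (\<chi> i j. M $ i $ j - t * N $ i $ j) = 0}"
proof -
  \<comment> \<open>A determinant over the polynomial ring: evaluation at t commutes with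
    \<open>det\<close>, so \<open>q\<close> is the pencil as a polynomial in t.\<close>
  define q where "q = det (\<chi> i j. [:M $ i $ j, - N $ i $ j:])"
  have sgn: "poly (of_int k) t = (of_int k :: 'a)" for k t
    by (simp add: of_int_poly)
  have q: "poly q t = det (\<chi> i j. M $ i $ j - t * N $ i $ j)" for t
    by (simp add: q_def det_def poly_sum poly_prod sgn)
  have "poly q 0 \<noteq> 0"
    unfolding q using assms by (simp add: vec_lambda_eta)
  then have "q \<noteq> 0"
    by auto
  then show ?thesis
    using poly_roots_finite[of q] by (simp add: q)
qed

lemma det_eq_0_if_kernel:
  fixes M :: "'a::field ^ 'k ^ 'k"
  assumes "\<And>i. (\<Sum>j\<in>UNIV. M $ i $ j * y j) = 0" and "y j \<noteq> 0"
  shows "det M = 0"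
proof (rule ccontr)
  assume "det M \<noteq> 0"
  then have "invertible M"
    by (simp add: invertible_det_nz)
  moreover have "M *v (\<chi> j. y j) = 0"
    using assms(1) by (simp add: matrix_vector_mult_def vec_eq_iff)
  ultimately have "(\<chi> j. y j) = 0"
    by (metis invertible_def matrix_left_invertible_ker)
  then show False
    using assms(2) by (metis vec_lambda_beta zero_index)
qed

lemma finite_vec_components:
  assumes "\<And>i::'n::finite. finite (S i)"
  shows "finite {x :: 'a ^ 'n. \<forall>i. x $ i \<in> S i}"
proof -
  have "finite (vec_lambda ` (\<Pi>\<^sub>E i\<in>UNIV. S i) :: ('a ^ 'n) set)"
    using assms by (intro finite_imageI finite_PiE) auto
  moreover have "{x :: 'a ^ 'n. \<forall>i. x $ i \<in> S i} \<subseteq> vec_lambda ` (\<Pi>\<^sub>E i\<in>UNIV. S i)"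
  proof
    fix x :: "'a ^ 'n" assume "x \<in> {x. \<forall>i. x $ i \<in> S i}"
    then show "x \<in> vec_lambda ` (\<Pi>\<^sub>E i\<in>UNIV. S i)"
      by (intro image_eqI[of _ _ "vec_nth x"]) auto
  qed
  ultimately show ?thesis
    by (rule rev_finite_subset)
qed

section \<open>Words as monomials\<close>

text \<open>Monomials of degree \<open>CARD('k)\<close> are indexed, redundantly, by words \<open>'k \<Rightarrow> 'n\<close>, since the index set
  of a matrix has to be a type.\<close>

definition mon :: "'a::comm_ring_1 ^ 'n::finite \<Rightarrow> ('k::finite \<Rightarrow> 'n) \<Rightarrow> 'a" where
  "mon x w = (\<Prod>k\<in>UNIV. x $ w k)"

definition overwrite :: "('p \<Rightarrow> 'k) \<Rightarrow> ('k \<Rightarrow> 'n) \<Rightarrow> ('p \<Rightarrow> 'n) \<Rightarrow> 'k \<Rightarrow> 'n" where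
  "overwrite e w h = (\<lambda>k. if k \<in> range e then h (inv e k) else w k)"

definition join :: "('m \<Rightarrow> 'n) \<Rightarrow> ('m \<Rightarrow> 'n) \<Rightarrow> 'm \<times> bool \<Rightarrow> 'n" where
  "join f g = (\<lambda>(q, b). if b then g q else f q)"

lemma mon_const: "mon x (\<lambda>_ :: 'k::finite. i) = x $ i ^ CARD('k)"
  by (simp add: mon_def)

lemma mon_overwrite:
  assumes "inj e"
  shows "mon x (overwrite e w h) = (\<Prod>k\<in>- range e. x $ w k) * mon x h"
proof -
  have "mon x (overwrite e w h) =
      (\<Prod>k\<in>range e. x $ overwrite e w h k) * (\<Prod>k\<in>- range e. x $ overwrite e w h k)"
    unfolding mon_def by (subst prod.union_disjoint[symmetric]) (auto simp: Un_commute)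
  also have "(\<Prod>k\<in>range e. x $ overwrite e w h k) = mon x h"
    using assms by (subst prod.reindex) (auto simp: mon_def overwrite_def)
  also have "(\<Prod>k\<in>- range e. x $ overwrite e w h k) = (\<Prod>k\<in>- range e. x $ w k)"
    by (intro prod.cong) (auto simp: overwrite_def)
  finally show ?thesis
    by (simp add: mult.commute)
qed

lemma mon_split:
  assumes "inj e"
  shows "mon x w = (\<Prod>k\<in>- range e. x $ w k) * mon x (w \<circ> e)"
proof -
  have "overwrite e w (w \<circ> e) = w"
    by (auto simp: overwrite_def f_inv_into_f)
  then show ?thesis
    using mon_overwrite[OF assms, of x w "w \<circ> e"] by simp
qed

lemma mon_join: "mon x (join f g) = mon x f * mon x g"
proof -
  have "mon x (join f g) = (\<Prod>q\<in>UNIV. \<Prod>b\<in>UNIV. x $ join f g (q, b))"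
    unfolding mon_def UNIV_Times_UNIV[symmetric] by (simp add: prod.cartesian_product)
  then show ?thesis
    by (simp add: mon_def join_def UNIV_bool prod.distrib mult.commute)
qed

text \<open>Pigeonhole: if every letter occurred fewer than \<open>CARD('p)\<close> times, the word
  would be shorter than \<open>CARD('n) * CARD('p)\<close>.\<close>

lemma frequent_letter:
  fixes w :: "'n::finite \<times> 'p::finite \<Rightarrow> 'n"
  shows "\<exists>i (e :: 'p \<Rightarrow> 'n \<times> 'p). inj e \<and> (\<forall>p. w (e p) = i)"
proof -
  have "\<exists>i. CARD('p) \<le> card (w -` {i})"
  proof (rule ccontr)
    assume "\<not> ?thesis"
    then have "(\<Sum>i\<in>UNIV. card (w -` {i})) < (\<Sum>i\<in>(UNIV::'n set). CARD('p))"
      by (intro sum_strict_mono) (auto simp: not_le)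
    moreover have "(\<Sum>i\<in>UNIV. card (w -` {i})) = card (\<Union>i\<in>UNIV. w -` {i})"
      by (subst card_UN_disjoint) auto
    moreover have "(\<Union>i\<in>UNIV. w -` {i}) = UNIV"
      by auto
    ultimately show False
      by simp
  qed
  then obtain i where "card (UNIV :: 'p set) \<le> card (w -` {i})"
    by blast
  then obtain e :: "'p \<Rightarrow> 'n \<times> 'p" where "e ` UNIV \<subseteq> w -` {i}" "inj e"
    using card_le_inj[of "UNIV :: 'p set" "w -` {i}"] by auto
  then show ?thesis
    by blast
qed

section \<open>Tensor forms in terms of words\<close>

lemma component_times_tensor_vec:
  "x $ i * tensor_vec A x $ i =
     (\<Sum>f\<in>UNIV. of_bool (f first_index = i) * (of_real (A $ f) * mon x f))"
proof -
  have mon: "mon x f = x $ f first_index * (\<Prod>k\<in>UNIV - {first_index}. x $ f k)" for f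
    unfolding mon_def by (rule prod.remove) auto
  have "x $ i * tensor_vec A x $ i =
      (\<Sum>f | f first_index = i. of_real (A $ f) * mon x f)"
    by (auto intro!: sum.cong simp: tensor_vec_def sum_distrib_left mon mult_ac)
  also have "\<dots> = (\<Sum>f\<in>UNIV. of_bool (f first_index = i) * (of_real (A $ f) * mon x f))"
    by (rule sum.mono_neutral_cong_left) auto
  finally show ?thesis .
qed

lemma tensor_form_eq_sum_mon:
  "tensor_form A x = (\<Sum>f\<in>UNIV. of_real (A $ f) * mon x f)"
proof -
  have "tensor_form A x = (\<Sum>f\<in>UNIV. \<Sum>i\<in>UNIV. of_bool (f first_index = i) * (of_real (A $ f) * mon x f))"
    unfolding tensor_form_def component_times_tensor_vec by (rule sum.swap)
  then show ?thesis
    by (simp add: sum_distrib_right[symmetric])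
qed

definition diag_tensor :: "('n \<Rightarrow> real) \<Rightarrow> ('m::{finite,linorder}, 'n::finite) tensor" where
  "diag_tensor a = (\<chi> f. if f = (\<lambda>_. f first_index) then a (f first_index) else 0)"

lemma component_times_tensor_vec_diag:
  fixes x :: "'a::{real_algebra_1,comm_ring_1} ^ 'n::finite"
  shows "x $ i * tensor_vec (diag_tensor a :: ('m::{finite,linorder}, 'n) tensor) x $ i =
     of_real (a i) * x $ i ^ CARD('m)"
proof -
  have "x $ i * tensor_vec (diag_tensor a :: ('m, 'n) tensor) x $ i =
      (\<Sum>f :: 'm \<Rightarrow> 'n\<in>UNIV. if f = (\<lambda>_. i) then of_real (a i) * mon x f else 0)"
    unfolding component_times_tensor_vec by (intro sum.cong) (auto simp: diag_tensor_def)
  then show ?thesis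
    by (simp add: mon_const)
qed

text \<open>One choice of coefficients for \<open>E\<^sub>i\<close> over pairs of words, polynomial
  in the entries of \<open>A\<close> and \<open>B\<close>.\<close>

definition elim_coeff ::
    "('n \<Rightarrow> real) \<Rightarrow> 'n \<Rightarrow> ('m::{finite,linorder}, 'n::finite) tensor \<Rightarrow> ('m, 'n) tensor \<Rightarrow>
       ('m \<Rightarrow> 'n) \<Rightarrow> ('m \<Rightarrow> 'n) \<Rightarrow> real" where
  "elim_coeff a i A B f g = of_bool (f = (\<lambda>_. i)) * B $ g -
     (\<Sum>j\<in>UNIV - {i}. A $ f * B $ g *
        (of_bool (f first_index = i) * of_bool (g first_index = j) -
         of_bool (f first_index = j) * of_bool (g first_index = i)) / (a i - a j))"

text \<open>The form \<open>E\<^sub>i\<close> of the overview, for arbitrary \<open>A\<close> and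
  \<open>B\<close>.\<close>

definition elim_form ::
    "('n \<Rightarrow> real) \<Rightarrow> 'n \<Rightarrow> ('m::{finite,linorder}, 'n::finite) tensor \<Rightarrow> ('m, 'n) tensor \<Rightarrow>
       complex ^ 'n \<Rightarrow> complex" where
  "elim_form a i A B x = x $ i ^ CARD('m) * tensor_form B x -
     (\<Sum>j\<in>UNIV - {i}. (x $ i * tensor_vec A x $ i * (x $ j * tensor_vec B x $ j) -
         x $ j * tensor_vec A x $ j * (x $ i * tensor_vec B x $ i)) / of_real (a i - a j))"

lemma elim_form_eq_sum:
  fixes x :: "complex ^ 'n::finite" and A B :: "('m::{finite,linorder}, 'n) tensor"
  shows "elim_form a i A B x =
     (\<Sum>f\<in>UNIV. \<Sum>g\<in>UNIV. of_real (elim_coeff a i A B f g) * (mon x f * mon x g))"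
proof -
  have 1: "x $ i ^ CARD('m) * tensor_form B x =
      (\<Sum>f :: 'm \<Rightarrow> 'n\<in>UNIV. \<Sum>g\<in>UNIV. of_real (of_bool (f = (\<lambda>_. i)) * B $ g) * (mon x f * mon x g))"
  proof -
    have "(\<Sum>f :: 'm \<Rightarrow> 'n\<in>UNIV. \<Sum>g\<in>UNIV. of_real (of_bool (f = (\<lambda>_. i)) * B $ g) * (mon x f * mon x g)) =
      (\<Sum>f :: 'm \<Rightarrow> 'n\<in>UNIV. of_bool (f = (\<lambda>_. i)) * mon x f) * tensor_form B x"
      unfolding tensor_form_eq_sum_mon sum_product
      by (intro sum.cong refl) (simp add: mult_ac)
    also have "(\<Sum>f :: 'm \<Rightarrow> 'n\<in>UNIV. of_bool (f = (\<lambda>_. i)) * mon x f) = x $ i ^ CARD('m)"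
      by (simp add: of_bool_def if_distrib[of "\<lambda>c. c * _"] mon_const cong: if_cong)
    finally show ?thesis ..
  qed
  have 2: "(x $ i * tensor_vec A x $ i * (x $ j * tensor_vec B x $ j) -
         x $ j * tensor_vec A x $ j * (x $ i * tensor_vec B x $ i)) / of_real (a i - a j) =
      (\<Sum>f\<in>UNIV. \<Sum>g\<in>UNIV. of_real (A $ f * B $ g *
        (of_bool (f first_index = i) * of_bool (g first_index = j) -
         of_bool (f first_index = j) * of_bool (g first_index = i)) / (a i - a j))
         * (mon x f * mon x g))" for j
    unfolding component_times_tensor_vec sum_product sum_subtractf[symmetric] sum_divide_distrib
    by (intro sum.cong refl) (simp add: algebra_simps diff_divide_distrib)
  show ?thesis
    unfolding elim_form_def 1 2
    by (subst sum.swap, subst (2) sum.swap)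
      (simp add: elim_coeff_def sum_subtractf left_diff_distrib sum_distrib_right)
qed

text \<open>The numerator for j is \<open>(a i - a j)\<close> times the m-th powers of
  \<open>x $ i\<close> and \<open>x $ j\<close>, so the subtracted sum removes exactly the mixed
  terms of the first product.\<close>

lemma elim_form_diag:
  fixes x :: "complex ^ 'n::finite"
  assumes "inj a"
  shows "elim_form a i (diag_tensor a :: ('m::{finite,linorder}, 'n) tensor) (diag_tensor (\<lambda>_. 1)) x =
     x $ i ^ CARD('m) * x $ i ^ CARD('m)"
proof -
  have "(\<Sum>j\<in>UNIV - {i}. (of_real (a i) * x $ i ^ CARD('m) * (x $ j ^ CARD('m)) -
      of_real (a j) * x $ j ^ CARD('m) * (x $ i ^ CARD('m))) / of_real (a i - a j)) =
    (\<Sum>j\<in>UNIV - {i}. x $ i ^ CARD('m) * x $ j ^ CARD('m))"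
    using assms by (intro sum.cong refl) (auto simp: field_simps inj_eq)
  moreover have "(\<Sum>j\<in>UNIV. x $ j ^ CARD('m)) = x $ i ^ CARD('m) + (\<Sum>j\<in>UNIV - {i}. x $ j ^ CARD('m))"
    by (rule sum.remove) auto
  ultimately show ?thesis
    by (simp add: elim_form_def tensor_form_def component_times_tensor_vec_diag
        sum_distrib_left distrib_left)
qed

text \<open>On the variety h is a scalar multiple of k, which makes every 2 by 2 minor in
  \<open>elim_form\<close> vanish.\<close>

lemma elim_form_variety:
  assumes "u \<in> complex_variety A B"
  shows "tensor_form B u = 1"
    and "elim_form a i (A :: ('m::{finite,linorder}, 'n::finite) tensor) B u = u $ i ^ CARD('m)"
proof -
  have eq: "eig_system A B u = 0"
    using assms by (simp add: complex_variety_def)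
  then show 1: "tensor_form B u = 1"
    by (simp add: eig_system_def zero_prod_def)
  have h: "u $ j * tensor_vec A u $ j = tensor_form A u * (u $ j * tensor_vec B u $ j)" for j
    using eq by (simp add: eig_system_def zero_prod_def vec_eq_iff) (metis mult.commute)
  then show "elim_form a i A B u = u $ i ^ CARD('m)"
    unfolding elim_form_def 1 h by (simp add: mult_ac)
qed

section \<open>The elimination matrix\<close>

text \<open>Row \<open>w\<close> contains the coefficients of the word expansion of \<open>elim_form\<close>, multiplied by the
  letters of \<open>w\<close> outside the range of \<open>e w\<close>. Different words can be the same monomial, so this row
  alone need not be a unit vector at the diagonal tensors; replacing its value there by the unit
  vector changes nothing after multiplication with the vector of monomials.\<close>

definition elim_matrix ::
    "('n \<Rightarrow> real) \<Rightarrow> (('k \<Rightarrow> 'n) \<Rightarrow> 'n) \<Rightarrow> (('k \<Rightarrow> 'n) \<Rightarrow> 'm \<times> bool \<Rightarrow> 'k) \<Rightarrow>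
       ('m::{finite,linorder}, 'n::finite) tensor \<Rightarrow> ('m, 'n) tensor \<Rightarrow>
       real ^ ('k::finite \<Rightarrow> 'n) ^ ('k \<Rightarrow> 'n)" where
  "elim_matrix a l e A B = (\<chi> w v. of_bool (v = w) +
     (\<Sum>f\<in>UNIV. \<Sum>g\<in>UNIV. of_bool (v = overwrite (e w) w (join f g)) *
        (elim_coeff a (l w) A B f g -
         elim_coeff a (l w) (diag_tensor a) (diag_tensor (\<lambda>_. 1)) f g)))"

lemma elim_matrix_diag: "elim_matrix a l e (diag_tensor a) (diag_tensor (\<lambda>_. 1)) = mat 1"
  by (auto simp: elim_matrix_def mat_def vec_eq_iff)

lemma real_polynomial_function_elim_matrix:
  "real_polynomial_function
     (\<lambda>p :: ('m::{finite,linorder}, 'n::finite) tensor \<times> ('m, 'n) tensor.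
        elim_matrix a l e (fst p) (snd p) $ w $ v)"
proof -
  have "real_polynomial_function (\<lambda>p :: ('m, 'n) tensor \<times> ('m, 'n) tensor. fst p $ f)"
    and "real_polynomial_function (\<lambda>p :: ('m, 'n) tensor \<times> ('m, 'n) tensor. snd p $ f)" for f
    by (auto intro!: real_polynomial_function.intros(1) bounded_linear_compose[OF bounded_linear_vec_nth]
        bounded_linear_fst bounded_linear_snd)
  then show ?thesis
    unfolding elim_matrix_def elim_coeff_def divide_inverse vec_lambda_beta
    by (intro real_polynomial_function_sum real_polynomial_function_diff
        real_polynomial_function.intros(2-) finite finite_Diff)
qed

lemma elim_matrix_mult_mon:
  fixes A B :: "('m::{finite,linorder}, 'n::finite) tensor"
  assumes "inj a" and e: "inj (e w)" "\<And>p. w (e w p) = l w"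
  shows "(\<Sum>v\<in>UNIV. of_real (elim_matrix a l e A B $ w $ v) * mon x v) =
     (\<Prod>k\<in>- range (e w). x $ w k) * elim_form a (l w) A B x"
proof -
  define r where "r = (\<Prod>k\<in>- range (e w). x $ w k)"
  define c where "c = (\<lambda>f g. elim_coeff a (l w) A B f g -
    elim_coeff a (l w) (diag_tensor a) (diag_tensor (\<lambda>_. 1)) f g)"
  have "(\<Sum>v\<in>UNIV. of_real (elim_matrix a l e A B $ w $ v) * mon x v) =
      (\<Sum>v\<in>UNIV. of_bool (v = w) * mon x v) +
      (\<Sum>v\<in>UNIV. \<Sum>f\<in>UNIV. \<Sum>g\<in>UNIV.
        of_bool (v = overwrite (e w) w (join f g)) * of_real (c f g) * mon x v)"
  proof -
    have "of_real (of_bool b) = (of_bool b :: complex)" for b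
      by (cases b) simp_all
    then show ?thesis
      unfolding elim_matrix_def c_def
      by (simp only: vec_lambda_beta of_real_add of_real_sum of_real_mult
          distrib_right sum.distrib sum_distrib_right)
  qed
  also have "(\<Sum>v\<in>UNIV. \<Sum>f\<in>UNIV. \<Sum>g\<in>UNIV.
        of_bool (v = overwrite (e w) w (join f g)) * of_real (c f g) * mon x v) =
      (\<Sum>f\<in>UNIV. \<Sum>g\<in>UNIV. \<Sum>v\<in>UNIV.
        of_bool (v = overwrite (e w) w (join f g)) * of_real (c f g) * mon x v)"
    by (subst sum.swap, intro sum.cong refl, rule sum.swap)
  also have "\<dots> = (\<Sum>f\<in>UNIV. \<Sum>g\<in>UNIV. of_real (c f g) * mon x (overwrite (e w) w (join f g)))"
    by (simp add: of_bool_def if_distrib[of "\<lambda>c. c * _"] cong: if_cong)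
  also have "\<dots> = r * (elim_form a (l w) A B x -
      elim_form a (l w) (diag_tensor a :: ('m, 'n) tensor) (diag_tensor (\<lambda>_. 1)) x)"
    unfolding elim_form_eq_sum sum_subtractf[symmetric] sum_distrib_left
    by (intro sum.cong refl) (simp add: mon_overwrite[OF e(1)] mon_join r_def c_def algebra_simps)
  \<comment> \<open>The diagonal form is the monomial of the letters at the positions
    \<open>range (e w)\<close>; times \<open>r\<close> it cancels the contribution
    \<open>mon x w\<close> of the unit vector.\<close>
  also have "elim_form a (l w) (diag_tensor a :: ('m, 'n) tensor) (diag_tensor (\<lambda>_. 1)) x =
      mon x (w \<circ> e w)"
  proof -
    have "w \<circ> e w = join (\<lambda>_. l w) (\<lambda>_. l w)"
      using e(2) by (auto simp: join_def)
    then show ?thesis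
      by (simp add: elim_form_diag[OF assms(1)] mon_join mon_const)
  qed
  also have "(\<Sum>v\<in>UNIV. of_bool (v = w) * mon x v) = r * mon x (w \<circ> e w)"
    unfolding r_def mon_split[OF e(1), symmetric]
    by (simp add: of_bool_def if_distrib[of "\<lambda>c. c * _"] cong: if_cong)
  finally show ?thesis
    by (simp add: r_def o_def algebra_simps)
qed

lemma finite_complex_variety:
  fixes A B :: "('m::{finite,linorder}, 'n::finite) tensor"
    and l :: "('k::finite \<Rightarrow> 'n) \<Rightarrow> 'n"
  assumes "inj a" and e: "\<And>w. inj (e w)" "\<And>w p. w (e w p) = l w"
    and D: "det (elim_matrix a l e A B) \<noteq> 0"
  shows "finite (complex_variety A B)"
proof -
  define M :: "complex ^ ('k \<Rightarrow> 'n) ^ ('k \<Rightarrow> 'n)"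
    where "M = (\<chi> w v. of_real (elim_matrix a l e A B $ w $ v))"
  \<comment> \<open>On the variety, row \<open>w\<close> of \<open>M\<close> yields a product of
    degree m too low. Multiplying by the m-th power of \<open>u $ i\<close> makes it a monomial
    again, whose word keeps \<open>l w\<close> in one half of the block and has \<open>i\<close> in
    the other.\<close>
  define N :: "'n \<Rightarrow> complex ^ ('k \<Rightarrow> 'n) ^ ('k \<Rightarrow> 'n)"
    where "N = (\<lambda>i. \<chi> w v. of_bool (v = overwrite (e w) w (join (\<lambda>_. l w) (\<lambda>_. i))))"
  define T where "T = (\<lambda>i. {t. det (\<chi> w v. M $ w $ v - t * N i $ w $ v) = 0})"
  have "det M \<noteq> 0"
    using D by (simp add: M_def det_of_real)
  then have finT: "finite (T i)" for i
    unfolding T_def by (rule finite_det_pencil)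
  have "finite {z. z = 0 \<or> inverse (z ^ CARD('m)) \<in> T i}" for i
  proof -
    have "finite (insert 0 (\<Union>t\<in>T i. {z. z ^ CARD('m) = inverse t}))"
      using finT[of i] by (auto intro!: finite_nth_roots)
    moreover have "{z. z = 0 \<or> inverse (z ^ CARD('m)) \<in> T i} \<subseteq>
        insert 0 (\<Union>t\<in>T i. {z. z ^ CARD('m) = inverse t})"
      by force
    ultimately show ?thesis
      by (rule rev_finite_subset)
  qed
  then have "finite {u :: complex ^ 'n. \<forall>i. u $ i \<in> {z. z = 0 \<or> inverse (z ^ CARD('m)) \<in> T i}}"
    by (rule finite_vec_components)
  moreover have "inverse (u $ i ^ CARD('m)) \<in> T i"
    if u: "u \<in> complex_variety A B" and "u $ i \<noteq> 0" for u i
  proof -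
    have "(\<Sum>v\<in>UNIV. (M $ w $ v - inverse (u $ i ^ CARD('m)) * N i $ w $ v) * mon u v) = 0" for w
    proof -
      have "(\<Sum>v\<in>UNIV. N i $ w $ v * mon u v) =
          (\<Prod>k\<in>- range (e w). u $ w k) * (u $ l w ^ CARD('m) * u $ i ^ CARD('m))"
        by (simp add: N_def of_bool_def if_distrib[of "\<lambda>c. c * _"] mon_overwrite[OF e(1)]
            mon_join mon_const cong: if_cong)
      moreover have "(\<Sum>v\<in>UNIV. M $ w $ v * mon u v) =
          (\<Prod>k\<in>- range (e w). u $ w k) * u $ l w ^ CARD('m)"
        using elim_matrix_mult_mon[of a e w l A B u] elim_form_variety(2)[OF u] assms(1) e
        by (simp add: M_def)
      ultimately show ?thesis
        using \<open>u $ i \<noteq> 0\<close>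
        by (simp add: left_diff_distrib sum_subtractf mult.assoc sum_distrib_left[symmetric])
    qed
    \<comment> \<open>The constant word \<open>i\<close> shows that the kernel vector is
      nonzero.\<close>
    moreover have "mon u (\<lambda>_. i) \<noteq> 0"
      using \<open>u $ i \<noteq> 0\<close> by (simp add: mon_const)
    ultimately show ?thesis
      unfolding T_def mem_Collect_eq by (intro det_eq_0_if_kernel) auto
  qed
  then have "complex_variety A B \<subseteq>
      {u. \<forall>i. u $ i \<in> {z. z = 0 \<or> inverse (z ^ CARD('m)) \<in> T i}}"
    by blast
  ultimately show ?thesis
    by (rule rev_finite_subset)
qed

theorem proposition4p4:
  shows "generic (\<lambda>(A :: ('m::{finite,linorder}, 'n::finite) tensor, B :: ('m, 'n) tensor).
           finite (complex_variety A B) \<and> finite (real_variety A B))"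
proof -
  obtain a :: "'n \<Rightarrow> real" where "inj a"
    using finite_imp_inj_to_nat_seg[of "UNIV :: 'n set"] inj_compose[OF inj_of_nat] by auto
  \<comment> \<open>Words have length 2mn over n letters, so some letter fills 2m positions, the
    degree of \<open>E\<^sub>i\<close>.\<close>
  have "\<exists>i (e :: 'm \<times> bool \<Rightarrow> 'n \<times> 'm \<times> bool). inj e \<and> (\<forall>p. w (e p) = i)"
    for w :: "'n \<times> 'm \<times> bool \<Rightarrow> 'n"
    by (rule frequent_letter)
  then obtain l and e :: "('n \<times> 'm \<times> bool \<Rightarrow> 'n) \<Rightarrow> 'm \<times> bool \<Rightarrow> 'n \<times> 'm \<times> bool"
    where e: "\<And>w. inj (e w)" "\<And>w p. w (e w p) = l w"
    by metis
  show ?thesis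
  proof (rule generic_if_nonzero_polynomial)
    show "real_polynomial_function (\<lambda>p :: ('m, 'n) tensor \<times> ('m, 'n) tensor.
        det (elim_matrix a l e (fst p) (snd p)))"
      by (intro real_polynomial_function_det real_polynomial_function_elim_matrix)
    show "det (elim_matrix a l e (fst (diag_tensor a, diag_tensor (\<lambda>_. 1)))
        (snd (diag_tensor a, diag_tensor (\<lambda>_. 1)))) \<noteq> 0"
      by (simp add: elim_matrix_diag)
    show "case p of (A, B) \<Rightarrow> finite (complex_variety A B) \<and> finite (real_variety A B)"
      if "det (elim_matrix a l e (fst p) (snd p)) \<noteq> 0" for p :: "('m, 'n) tensor \<times> ('m, 'n) tensor"
      using finite_complex_variety[OF \<open>inj a\<close> e that] by (auto simp: real_variety_def)
  qed
qed

end
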